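(* For any $\epsilon>0$ there exists a sequence $\{\mathbb{P}^{(k)}\}_{k\in\mathbb{N}}$ of symmetric, continuous probability distributions on $\mathbb{R}$ with means satisfying $|\mathbb{E}^{(k)}[c]|\ge\epsilon$ such that $$\mathbb{E}^{(k)}[c]\left(\mathbb{P}^{(k)}[c>0]-\mathbb{P}^{(k)}[c<0]\right)\to0\quad\text{as }k\to\infty.$$ Consequently, in the setting $m=1$, $f=0$, $X=[-1/2,1/2]$, $C=\mathbb{R}$, the loss $\ell_{\mathrm{SPO+}}$ is not $\mathcal{P}_{\mathrm{cont,sym}}$-uniformly calibrated.
   Context: A probability distribution on $\mathbb{R}$ is called continuous if it has a density with respect to Lebesgue measure that is positive on all of $\mathbb{R}$, and symmetric if it has finite mean $\mu$ and, for $c$ with this distribution, $c-\mu$ and $\mu-c$ have the same distribution. One-dimensional setting: $m=1$, $f=0$, $X=[-1/2,1/2]$, $C=\mathbb{R}$, $W\subseteq\mathbb{R}^k$ non-empty and measurable. Here $x^*(d)=-1/2$ if $d>0$, $x^*(0)=0$, $x^*(d)=1/2$ if $d<0$; the true loss is $L(d,c):=c\,x^*(d)-\min_{x\in X}cx$; and $$\ell_{\mathrm{SPO+}}(d,c):=\tfrac12\left(|2d-c|-2d\,\mathrm{sign}(c)+|c|\right),\quad \mathrm{sign}(0)=0.$$ For a distribution $\mathbb{P}$ on $W\times\mathbb{R}$, $(w,c)\sim\mathbb{P}$ and $\mathbb{P}[\cdot\mid w]$, $\mathbb{E}[\cdot\mid w]$ refer to a fixed regular conditional distribution of $c$ defined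 for every $w\in W$. $\mathcal{P}_{\mathrm{cont,sym}}$ is the class of distributions $\mathbb{P}$ on $W\times\mathbb{R}$ such that for every $w\in W$ the conditional distribution of $c$ given $w$ is continuous and symmetric. A loss $\ell$ is $\mathcal{P}$-uniformly calibrated if for all $\epsilon>0$ there is $\delta>0$ such that for all $\mathbb{P}\in\mathcal{P}$, $w\in W$, $d\in\mathbb{R}$: $\mathbb{E}[\ell(d,c)\mid w]-\inf_{d'}\mathbb{E}[\ell(d',c)\mid w]<\delta$ implies $\mathbb{E}[L(d,c)\mid w]-\inf_{d'}\mathbb{E}[L(d',c)\mid w]<\epsilon$. *)

theory Defs
  imports "HOL-Probability.Probability"
begin

definition mean :: "real measure \<Rightarrow> real" where
  "mean M = (LINT c|M. c)"

definition continuous_distribution :: "real measure \<Rightarrow> bool" where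
  "continuous_distribution M \<longleftrightarrow>
     real_distribution M \<and>
     (\<exists>f::real \<Rightarrow> real. f \<in> borel_measurable borel \<and> (\<forall>x. 0 < f x) \<and>
        M = density lborel (\<lambda>x. ennreal (f x)))"

definition symmetric_distribution :: "real measure \<Rightarrow> bool" where
  "symmetric_distribution M \<longleftrightarrow>
     real_distribution M \<and>
     integrable M (\<lambda>c. c) \<and>
     distr M borel (\<lambda>c. c - mean M) = distr M borel (\<lambda>c. mean M - c)"

definition feasible :: "real set" where
  "feasible = {-1/2..1/2}"

definition x_star :: "real \<Rightarrow> real" where
  "x_star d = (if d > 0 then -1/2 else if d = 0 then 0 else 1/2)"

text \<open>The minimum of the linear function over the compact interval is attained, so the
  infimum below is a minimum.\<close>

definition true_loss :: "real \<Rightarrow> real \<Rightarrow> real" where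
  "true_loss d c = c * x_star d - (INF x\<in>feasible. c * x)"

definition spo_plus :: "real \<Rightarrow> real \<Rightarrow> real" where
  "spo_plus d c = (\<bar>2 * d - c\<bar> - 2 * d * sgn c + \<bar>c\<bar>) / 2"

text \<open>A distribution on \<open>W \<times> \<real>\<close> is a measure on the product of the trace of the Borel
  sigma-algebra on \<open>W\<close> with the Borel sigma-algebra of the line.\<close>

definition distribution_on :: "(real ^ 'k) set \<Rightarrow> ((real ^ 'k) \<times> real) measure \<Rightarrow> bool" where
  "distribution_on W P \<longleftrightarrow>
     prob_space P \<and> sets P = sets (restrict_space borel W \<Otimes>\<^sub>M borel)"

text \<open>\<open>K\<close> is a regular conditional distribution of the second coordinate given the first: a
  Markov kernel, defined at every point of \<open>W\<close>, that disintegrates \<open>P\<close> over its first marginal.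
  Values of \<open>K\<close> outside \<open>W\<close> are irrelevant.\<close>

definition regular_conditional_distribution ::
    "(real ^ 'k) set \<Rightarrow> ((real ^ 'k) \<times> real) measure \<Rightarrow> ((real ^ 'k) \<Rightarrow> real measure) \<Rightarrow> bool" where
  "regular_conditional_distribution W P K \<longleftrightarrow>
     K \<in> measurable (restrict_space borel W) (prob_algebra borel) \<and>
     (\<forall>A\<in>sets (restrict_space borel W). \<forall>B\<in>sets borel.
        emeasure P (A \<times> B) =
          (\<integral>\<^sup>+w\<in>A. emeasure (K w) B \<partial>distr P (restrict_space borel W) fst))"

text \<open>A regular conditional distribution is determined by \<open>P\<close> only almost everywhere, whereas
  the notions below refer to its value at every \<open>w\<close>. Each distribution therefore carries the
  version that has been fixed for it, and classes of distributions are sets of pairs.\<close>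

type_synonym 'k conditioned_distribution =
  "((real ^ 'k) \<times> real) measure \<times> ((real ^ 'k) \<Rightarrow> real measure)"

definition P_cont_sym :: "(real ^ 'k) set \<Rightarrow> 'k conditioned_distribution set" where
  "P_cont_sym W =
     {(P, K). distribution_on W P \<and> regular_conditional_distribution W P K \<and>
        (\<forall>w\<in>W. continuous_distribution (K w) \<and> symmetric_distribution (K w))}"

text \<open>The excess of the expected loss over its infimum, for \<open>c\<close> distributed as \<open>M\<close>. Both
  \<open>spo_plus\<close> and \<open>true_loss\<close> are nonnegative and of at most linear growth in \<open>c\<close>, so for \<open>M\<close>
  with finite mean the integrals exist and the infimum is over a set bounded below.\<close>

definition excess_risk :: "(real \<Rightarrow> real \<Rightarrow> real) \<Rightarrow> real measure \<Rightarrow> real \<Rightarrow> real" where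
  "excess_risk l M d = (LINT c|M. l d c) - (INF d'. LINT c|M. l d' c)"

definition uniformly_calibrated ::
    "(real ^ 'k) set \<Rightarrow> 'k conditioned_distribution set \<Rightarrow> (real \<Rightarrow> real \<Rightarrow> real) \<Rightarrow> bool" where
  "uniformly_calibrated W \<P> l \<longleftrightarrow>
     (\<forall>\<epsilon>>0. \<exists>\<delta>>0. \<forall>(P, K)\<in>\<P>. \<forall>w\<in>W. \<forall>d.
        excess_risk l (K w) d < \<delta> \<longrightarrow> excess_risk true_loss (K w) d < \<epsilon>)"

end

theory Submission
  imports Defs
begin

text \<open>Normal distributions with fixed mean \<open>\<mu> > 0\<close> and standard deviation tending to infinity:
  by symmetry the gap between the probabilities of \<open>c > 0\<close> and \<open>c < 0\<close> is the probability of
  \<open>0 < c \<le> 2 * \<mu>\<close>, which vanishes because the density flattens out. The gap times the mean bounds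
  the SPO+ excess risk of the prediction \<open>d = 0\<close>, whose true excess risk is at least \<open>\<mu> / 2\<close>.\<close>

section \<open>Reflection about the mean\<close>

lemma symmetric_distribution_reflect:
  assumes "symmetric_distribution M"
  shows "distr M borel (\<lambda>c. 2 * mean M - c) = M"
proof -
  interpret real_distribution M
    using assms by (simp add: symmetric_distribution_def)
  \<comment> \<open>Shifting both centred laws back by the mean turns one into the reflected law and
    the other into \<open>M\<close> itself.\<close>
  have "distr (distr M borel (\<lambda>c. mean M - c)) borel (\<lambda>c. c + mean M) =
        distr (distr M borel (\<lambda>c. c - mean M)) borel (\<lambda>c. c + mean M)"
    using assms by (simp add: symmetric_distribution_def)
  also have "\<dots> = distr M borel (\<lambda>c. c)"
    by (subst distr_distr) (simp_all add: comp_def)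
  also have "\<dots> = M"
    by (intro distr_id2) simp
  finally show ?thesis
    by (subst (asm) distr_distr) (simp_all add: comp_def algebra_simps)
qed

lemma symmetric_distribution_integral_reflect:
  fixes h :: "real \<Rightarrow> real"
  assumes "symmetric_distribution M" and [measurable]: "h \<in> borel_measurable borel"
  shows "(LINT c|M. h (2 * mean M - c)) = (LINT c|M. h c)"
proof -
  interpret real_distribution M
    using assms by (simp add: symmetric_distribution_def)
  have "(LINT c|M. h c) = (LINT c|distr M borel (\<lambda>c. 2 * mean M - c). h c)"
    by (simp add: symmetric_distribution_reflect[OF assms(1)])
  also have "\<dots> = (LINT c|M. h (2 * mean M - c))"
    by (subst integral_distr) simp_all
  finally show ?thesis ..
qed

text \<open>For a positive mean this turns the sign gap into the mass of a bounded interval, which a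
  bound on the density controls.\<close>

lemma symmetric_distribution_measure_reflect:
  assumes "symmetric_distribution M"
  shows "measure M {c. c < 0} = measure M {c. 2 * mean M < c}"
proof -
  interpret real_distribution M
    using assms by (simp add: symmetric_distribution_def)
  have "measure M {c. c < 0} = measure (distr M borel (\<lambda>c. 2 * mean M - c)) {c. c < 0}"
    by (simp add: symmetric_distribution_reflect[OF assms])
  also have "\<dots> = measure M {c. 2 * mean M < c}"
    by (subst measure_distr) (auto simp: vimage_def)
  finally show ?thesis .
qed

section \<open>Excess risk of the SPO+ loss\<close>

lemma integral_sgn:
  assumes "real_distribution M"
  shows "(LINT c|M. sgn c) = measure M {c. c > 0} - measure M {c. c < 0}"
proof -
  interpret real_distribution M by fact
  have "(LINT c|M. sgn c) = (LINT c|M. indicator {c. c > 0} c - indicator {c. c < 0} c)"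
    by (intro Bochner_Integration.integral_cong) (auto simp: sgn_if)
  also have "\<dots> = measure M {c. c > 0} - measure M {c. c < 0}"
    by (subst Bochner_Integration.integral_diff)
      (auto intro!: integrable_real_indicator simp: emeasure_eq_measure)
  finally show ?thesis .
qed

text \<open>At \<open>d = mean M\<close> the subgradient \<open>E (sgn (2 * d - c)) - E (sgn c)\<close> of the expected loss
  vanishes by symmetry, so the mean is a minimiser.\<close>

lemma spo_plus_expectation_ge:
  assumes sym: "symmetric_distribution M"
  shows "(LINT c|M. spo_plus d c) \<ge>
         (LINT c|M. \<bar>c\<bar>) - mean M * (measure M {c. c > 0} - measure M {c. c < 0})"
proof -
  interpret real_distribution M
    using sym by (simp add: symmetric_distribution_def)
  let ?\<mu> = "mean M"
  have int[simp]: "integrable M (\<lambda>c. c)"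
    using sym by (simp add: symmetric_distribution_def)
  have int_sgn[simp]: "integrable M (\<lambda>c. sgn (a - c))" "integrable M (\<lambda>c. sgn c)" for a :: real
    by (auto intro!: integrable_const_bound[where B=1] simp: sgn_if)
  have int_abs[simp]: "integrable M (\<lambda>c. \<bar>a - c\<bar>)" for a :: real
    by simp
  have refl: "(LINT c|M. \<bar>2 * ?\<mu> - c\<bar>) = (LINT c|M. \<bar>c\<bar>)"
    "(LINT c|M. sgn (2 * ?\<mu> - c)) = (LINT c|M. sgn c)"
    using symmetric_distribution_integral_reflect[OF sym, of abs]
      symmetric_distribution_integral_reflect[OF sym, of sgn] by simp_all
  have "(LINT c|M. \<bar>c\<bar>) + 2 * (d - ?\<mu>) * (LINT c|M. sgn c) =
      (LINT c|M. \<bar>2 * ?\<mu> - c\<bar> + 2 * (d - ?\<mu>) * sgn (2 * ?\<mu> - c))"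
    by (simp add: refl)
  also have "\<dots> \<le> (LINT c|M. \<bar>2 * d - c\<bar>)"
  proof (rule integral_mono)
    \<comment> \<open>Subgradient inequality for the absolute value at
      \<open>2 * ?\<mu> - c\<close>; at the kink \<open>sgn\<close> gives 0, which is also a
      subgradient.\<close>
    show "\<bar>2 * ?\<mu> - c\<bar> + 2 * (d - ?\<mu>) * sgn (2 * ?\<mu> - c) \<le> \<bar>2 * d - c\<bar>" for c
      by (auto simp: sgn_if)
  qed simp_all
  finally have "(LINT c|M. \<bar>c\<bar>) + 2 * (d - ?\<mu>) * (LINT c|M. sgn c) \<le> (LINT c|M. \<bar>2 * d - c\<bar>)" .
  moreover have "(LINT c|M. spo_plus d c) =
      ((LINT c|M. \<bar>2 * d - c\<bar>) - 2 * d * (LINT c|M. sgn c) + (LINT c|M. \<bar>c\<bar>)) / 2"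
    by (simp add: spo_plus_def)
  \<comment> \<open>The terms in \<open>d\<close> cancel: the slope of the tangent bound is what the
    linear term of \<open>spo_plus\<close> subtracts. The lower bound is therefore uniform in
    \<open>d\<close>.\<close>
  ultimately show ?thesis
    using integral_sgn[of M] by (simp add: real_distribution_axioms field_simps)
qed

text \<open>Since \<open>spo_plus 0 c\<close> equals \<open>\<bar>c\<bar>\<close>, the risk at 0
  exceeds the uniform lower bound by exactly the mean times the gap.\<close>

lemma spo_plus_excess_risk_zero_le:
  assumes "symmetric_distribution M"
  shows "excess_risk spo_plus M 0 \<le> mean M * (measure M {c. c > 0} - measure M {c. c < 0})"
proof -
  have "(INF d'. LINT c|M. spo_plus d' c) \<ge>
      (LINT c|M. \<bar>c\<bar>) - mean M * (measure M {c. c > 0} - measure M {c. c < 0})"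
    by (intro cINF_greatest spo_plus_expectation_ge assms) simp
  moreover have "(LINT c|M. spo_plus 0 c) = (LINT c|M. \<bar>c\<bar>)"
    by (simp add: spo_plus_def)
  ultimately show ?thesis
    by (simp add: excess_risk_def)
qed

section \<open>Excess risk of the true loss\<close>

lemma true_loss_eq: "true_loss d c = c * x_star d + \<bar>c\<bar> / 2"
proof -
  have "(INF x\<in>feasible. c * x) = - \<bar>c\<bar> / 2"
  proof (rule cInf_eq_minimum)
    show "- \<bar>c\<bar> / 2 \<in> (\<lambda>x. c * x) ` feasible"
      \<comment> \<open>The minimiser is the endpoint opposite in sign to \<open>c\<close>; for
        \<open>c = 0\<close> the witness is the midpoint.\<close>
      by (rule image_eqI[of _ _ "- sgn c / 2"]) (auto simp: feasible_def sgn_if)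
  next
    fix y assume "y \<in> (\<lambda>x. c * x) ` feasible"
    then obtain x where "x \<in> feasible" and y: "y = c * x"
      by blast
    then have x: "\<bar>x\<bar> \<le> 1 / 2"
      by (auto simp: feasible_def)
    have "\<bar>c * x\<bar> \<le> \<bar>c\<bar> * (1 / 2)"
      unfolding abs_mult using x by (intro mult_left_mono) auto
    then show "- \<bar>c\<bar> / 2 \<le> y"
      using y by linarith
  qed
  then show ?thesis
    by (simp add: true_loss_def)
qed

text \<open>Prediction 0 leads to the midpoint decision, prediction 1 to the decision -1/2, and the
  latter is cheaper by \<open>mean M / 2\<close> in expectation. Comparing these two suffices for a
  lower bound.\<close>

lemma true_loss_excess_risk_zero_ge:
  assumes "real_distribution M" and int[simp]: "integrable M (\<lambda>c. c)"
  shows "excess_risk true_loss M 0 \<ge> mean M / 2"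
proof -
  interpret real_distribution M by fact
  have E: "(LINT c|M. true_loss d c) = mean M * x_star d + (LINT c|M. \<bar>c\<bar>) / 2" for d
    by (simp add: true_loss_eq mean_def)
  \<comment> \<open>On the reals, \<open>INF\<close> is known to lie below the values only if these
    are bounded below; here the decisions stay within 1/2 of 0.\<close>
  have "bdd_below (range (\<lambda>d'. LINT c|M. true_loss d' c))"
  proof (rule bdd_belowI2)
    fix d
    have "\<bar>mean M * x_star d\<bar> \<le> \<bar>mean M\<bar> / 2"
      by (auto simp: x_star_def abs_mult)
    then show "- \<bar>mean M\<bar> / 2 + (LINT c|M. \<bar>c\<bar>) / 2 \<le> (LINT c|M. true_loss d c)"
      unfolding E by linarith
  qed
  then have "(INF d'. LINT c|M. true_loss d' c) \<le> (LINT c|M. true_loss 1 c)"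
    by (intro cINF_lower) auto
  then show ?thesis
    by (simp add: excess_risk_def E x_star_def)
qed

section \<open>Normal distributions with growing spread\<close>

definition normal_measure :: "real \<Rightarrow> real \<Rightarrow> real measure" where
  "normal_measure \<mu> \<sigma> = density lborel (\<lambda>x. ennreal (normal_density \<mu> \<sigma> x))"

lemma sets_normal_measure [measurable_cong, simp]: "sets (normal_measure \<mu> \<sigma>) = sets borel"
  by (simp add: normal_measure_def)

lemma space_normal_measure [simp]: "space (normal_measure \<mu> \<sigma>) = UNIV"
  by (simp add: normal_measure_def)

lemma prob_space_normal_measure: "0 < \<sigma> \<Longrightarrow> prob_space (normal_measure \<mu> \<sigma>)"
  unfolding normal_measure_def by (rule prob_space_normal_density)

lemma real_distribution_normal_measure: "0 < \<sigma> \<Longrightarrow> real_distribution (normal_measure \<mu> \<sigma>)"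
  by (simp add: real_distribution_def real_distribution_axioms_def prob_space_normal_measure)

lemma continuous_distribution_normal_measure:
  "0 < \<sigma> \<Longrightarrow> continuous_distribution (normal_measure \<mu> \<sigma>)"
  unfolding continuous_distribution_def
  by (intro conjI real_distribution_normal_measure exI[of _ "normal_density \<mu> \<sigma>"])
    (auto simp: normal_density_pos normal_measure_def)

text \<open>Views the identity as a normal random variable on its own law, so that facts phrased
  through \<open>distributed\<close> (expectation, affine images) apply.\<close>

lemma distributed_normal_measure:
  "distributed (normal_measure \<mu> \<sigma>) lborel (\<lambda>x. x) (normal_density \<mu> \<sigma>)"
proof -
  have "distr (normal_measure \<mu> \<sigma>) lborel (\<lambda>x. x) = normal_measure \<mu> \<sigma>"
    by (rule distr_id2) simp
  then show ?thesis
    by (simp add: distributed_def normal_measure_def)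
qed

lemma mean_normal_measure:
  assumes "0 < \<sigma>"
  shows "mean (normal_measure \<mu> \<sigma>) = \<mu>"
  unfolding mean_def
  using prob_space.normal_distributed_expectation[OF prob_space_normal_measure[OF assms]
      assms distributed_normal_measure] .

lemma integrable_normal_measure:
  assumes "0 < \<sigma>"
  shows "integrable (normal_measure \<mu> \<sigma>) (\<lambda>c. c)"
  unfolding normal_measure_def using integrable_normal_moment_nz_1[OF assms]
  by (subst integrable_density) auto

lemma distr_affine_normal_measure:
  assumes "0 < \<sigma>" "\<alpha> \<noteq> 0"
  shows "distr (normal_measure \<mu> \<sigma>) borel (\<lambda>c. \<beta> + \<alpha> * c) = normal_measure (\<beta> + \<alpha> * \<mu>) (\<bar>\<alpha>\<bar> * \<sigma>)"
proof -
  interpret prob_space "normal_measure \<mu> \<sigma>"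
    using assms(1) by (rule prob_space_normal_measure)
  \<comment> \<open>\<open>distributed\<close> has \<open>lborel\<close> as its target; only the
    sigma-algebra of the target matters to \<open>distr\<close>.\<close>
  have "distr (normal_measure \<mu> \<sigma>) borel (\<lambda>c. \<beta> + \<alpha> * c) =
        distr (normal_measure \<mu> \<sigma>) lborel (\<lambda>c. \<beta> + \<alpha> * c)"
    by (rule distr_cong) simp_all
  also have "\<dots> = normal_measure (\<beta> + \<alpha> * \<mu>) (\<bar>\<alpha>\<bar> * \<sigma>)"
    using normal_density_affine[OF distributed_normal_measure assms, of \<beta>]
    by (simp add: distributed_def normal_measure_def)
  finally show ?thesis .
qed

text \<open>Both centred variables are affine images, with slopes 1 and -1, and both are normal with
  mean 0 and deviation \<open>\<sigma>\<close>.\<close>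

lemma symmetric_distribution_normal_measure:
  assumes "0 < \<sigma>"
  shows "symmetric_distribution (normal_measure \<mu> \<sigma>)"
  using distr_affine_normal_measure[OF assms, of 1 \<mu> "- \<mu>"]
    distr_affine_normal_measure[OF assms, of "-1" \<mu> \<mu>]
  by (simp add: symmetric_distribution_def real_distribution_normal_measure
      integrable_normal_measure mean_normal_measure assms)

lemma normal_density_le: "0 < \<sigma> \<Longrightarrow> normal_density \<mu> \<sigma> x \<le> 1 / (sqrt (2 * pi) * \<sigma>)"
  by (simp add: normal_density_def real_sqrt_mult divide_simps)

text \<open>Peak height of the density times length: the mass of a fixed interval decays like the
  inverse of \<open>\<sigma>\<close>.\<close>

lemma measure_normal_measure_interval_le:
  assumes "0 < \<sigma>" "a \<le> b"
  shows "measure (normal_measure \<mu> \<sigma>) {a<..b} \<le> (b - a) / (sqrt (2 * pi) * \<sigma>)"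
proof -
  have "emeasure (normal_measure \<mu> \<sigma>) {a<..b} =
      (\<integral>\<^sup>+x\<in>{a<..b}. ennreal (normal_density \<mu> \<sigma> x) \<partial>lborel)"
    unfolding normal_measure_def by (subst emeasure_density) simp_all
  also have "\<dots> \<le> (\<integral>\<^sup>+x\<in>{a<..b}. ennreal (1 / (sqrt (2 * pi) * \<sigma>)) \<partial>lborel)"
    using assms by (intro nn_integral_mono mult_right_mono ennreal_leI normal_density_le) auto
  also have "\<dots> = ennreal (1 / (sqrt (2 * pi) * \<sigma>)) * ennreal (b - a)"
    using assms by (subst nn_integral_cmult_indicator) simp_all
  also have "\<dots> = ennreal ((b - a) / (sqrt (2 * pi) * \<sigma>))"
    using assms by (subst ennreal_mult[symmetric]) simp_all
  finally show ?thesis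
    using assms unfolding measure_def by (intro enn2real_leI) auto
qed

lemma normal_measure_sign_gap:
  assumes "0 < \<sigma>" "0 < \<mu>"
  shows "measure (normal_measure \<mu> \<sigma>) {c. c > 0} - measure (normal_measure \<mu> \<sigma>) {c. c < 0}
         \<in> {0..2 * \<mu> / (sqrt (2 * pi) * \<sigma>)}"
proof -
  let ?M = "normal_measure \<mu> \<sigma>"
  interpret prob_space ?M
    using assms(1) by (rule prob_space_normal_measure)
  have "measure ?M {c. c > 0} - measure ?M {c. 2 * \<mu> < c} = measure ?M ({c. c > 0} - {c. 2 * \<mu> < c})"
    using assms by (subst finite_measure_Diff) auto
  also have "{c. c > 0} - {c. 2 * \<mu> < c} = {0<..2 * \<mu>}"
    by auto
  finally show ?thesis
    using measure_normal_measure_interval_le[of \<sigma> 0 "2 * \<mu>" \<mu>] assms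
      symmetric_distribution_measure_reflect[OF symmetric_distribution_normal_measure[of \<sigma> \<mu>]]
    by (simp add: mean_normal_measure)
qed

text \<open>The deviation \<open>Suc k\<close> is positive also at \<open>k = 0\<close>; the product
  is squeezed between 0 and a multiple of its inverse.\<close>

lemma normal_measure_gap_tendsto_zero:
  assumes "0 < \<mu>"
  shows "(\<lambda>k. \<mu> * (measure (normal_measure \<mu> (real (Suc k))) {c. c > 0} -
                   measure (normal_measure \<mu> (real (Suc k))) {c. c < 0})) \<longlonglongrightarrow> 0"
proof (rule tendsto_sandwich[OF _ _ tendsto_const])
  have "(\<lambda>k. \<mu> * (2 * \<mu> / sqrt (2 * pi) * inverse (real (Suc k)))) \<longlonglongrightarrow> \<mu> * (2 * \<mu> / sqrt (2 * pi) * 0)"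
    by (intro tendsto_intros LIMSEQ_inverse_real_of_nat)
  then show "(\<lambda>k. \<mu> * (2 * \<mu> / (sqrt (2 * pi) * real (Suc k)))) \<longlonglongrightarrow> 0"
    by (simp add: field_simps)
  let ?gap = "\<lambda>k. measure (normal_measure \<mu> (real (Suc k))) {c. c > 0} -
    measure (normal_measure \<mu> (real (Suc k))) {c. c < 0}"
  have "?gap k \<in> {0..2 * \<mu> / (sqrt (2 * pi) * real (Suc k))}" for k
    using assms by (intro normal_measure_sign_gap) simp_all
  then show "\<forall>\<^sub>F k in sequentially. 0 \<le> \<mu> * ?gap k"
    and "\<forall>\<^sub>F k in sequentially. \<mu> * ?gap k \<le> \<mu> * (2 * \<mu> / (sqrt (2 * pi) * real (Suc k)))"
    using assms by (auto intro!: always_eventually mult_nonneg_nonneg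
        mult_left_mono[of "?gap _"] simp del: times_divide_eq_right of_nat_Suc)
qed

section \<open>Realisation by a joint distribution\<close>

text \<open>The covariate may as well be deterministic: the kernel is constant, and the conditions
  of calibration refer to the kernel only.\<close>

lemma constant_kernel_in_P_cont_sym:
  fixes W :: "(real ^ 'k) set"
  assumes "w \<in> W" and M: "continuous_distribution M" "symmetric_distribution M"
  shows "(return (restrict_space borel W) w \<Otimes>\<^sub>M M, \<lambda>_. M) \<in> P_cont_sym W"
proof -
  let ?R = "return (restrict_space borel W) w"
  interpret M: real_distribution M
    using M(2) by (simp add: symmetric_distribution_def)
  interpret R: prob_space ?R
    using assms(1) by (intro prob_space_return) (simp add: space_restrict_space)
  interpret pair_prob_space ?R M ..
  have "distribution_on W (?R \<Otimes>\<^sub>M M)"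
    unfolding distribution_on_def
    by (intro conjI prob_space_axioms sets_pair_measure_cong) simp_all
  moreover have "regular_conditional_distribution W (?R \<Otimes>\<^sub>M M) (\<lambda>_. M)"
    unfolding regular_conditional_distribution_def
  proof (intro conjI ballI)
    show "(\<lambda>_. M) \<in> restrict_space borel W \<rightarrow>\<^sub>M prob_algebra borel"
      by (intro measurable_const) (simp add: space_prob_algebra M.prob_space_axioms)
  next
    fix A and B :: "real set"
    assume A: "A \<in> sets (restrict_space borel W)" and B: "B \<in> sets borel"
    \<comment> \<open>The target is replaced by \<open>?R\<close>, which has the same sigma-algebra,
      to match the form of the fact on first marginals.\<close>
    have "distr (?R \<Otimes>\<^sub>M M) (restrict_space borel W) fst = distr (?R \<Otimes>\<^sub>M M) ?R fst"
      by (rule distr_cong) simp_all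
    also have "\<dots> = ?R"
      by (rule M.distr_pair_fst)
    finally show "emeasure (?R \<Otimes>\<^sub>M M) (A \<times> B) =
        (\<integral>\<^sup>+w\<in>A. emeasure M B \<partial>distr (?R \<Otimes>\<^sub>M M) (restrict_space borel W) fst)"
      using A B by (simp add: M.emeasure_pair_measure_Times nn_integral_cmult_indicator
          mult.commute[of "indicator A w"])
  qed
  ultimately show ?thesis
    using M by (simp add: P_cont_sym_def)
qed

section \<open>Failure of uniform calibration\<close>

theorem proposition1:
  fixes W :: "(real ^ 'k) set"
  assumes "W \<in> sets borel" and "W \<noteq> {}"
  shows "(\<forall>\<epsilon>>0. \<exists>P :: nat \<Rightarrow> real measure.
            (\<forall>k. symmetric_distribution (P k) \<and> continuous_distribution (P k) \<and>
                 \<bar>mean (P k)\<bar> \<ge> \<epsilon>) \<and>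
            (\<lambda>k. mean (P k) * (measure (P k) {c. c > 0} - measure (P k) {c. c < 0}))
              \<longlonglongrightarrow> 0)
         \<and> \<not> uniformly_calibrated W (P_cont_sym W) spo_plus"
proof (intro conjI allI impI)
  fix \<epsilon> :: real assume \<epsilon>: "0 < \<epsilon>"
  show "\<exists>P :: nat \<Rightarrow> real measure.
            (\<forall>k. symmetric_distribution (P k) \<and> continuous_distribution (P k) \<and>
                 \<bar>mean (P k)\<bar> \<ge> \<epsilon>) \<and>
            (\<lambda>k. mean (P k) * (measure (P k) {c. c > 0} - measure (P k) {c. c < 0}))
              \<longlonglongrightarrow> 0"
    using normal_measure_gap_tendsto_zero[OF \<epsilon>] \<epsilon>
    by (intro exI[of _ "\<lambda>k. normal_measure \<epsilon> (real (Suc k))"])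
      (simp add: mean_normal_measure symmetric_distribution_normal_measure
        continuous_distribution_normal_measure del: of_nat_Suc)
next
  show "\<not> uniformly_calibrated W (P_cont_sym W) spo_plus"
  proof
    assume "uniformly_calibrated W (P_cont_sym W) spo_plus"
    \<comment> \<open>The tolerance 1/2 is the lower bound on the true excess risk of
      \<open>d = 0\<close> at mean 1. With that mean, the vanishing product is the gap
      itself.\<close>
    then obtain \<delta> where "0 < \<delta>" and \<delta>: "\<And>P K w d. (P, K) \<in> P_cont_sym W \<Longrightarrow> w \<in> W \<Longrightarrow>
        excess_risk spo_plus (K w) d < \<delta> \<Longrightarrow> excess_risk true_loss (K w) d < 1 / 2"
      unfolding uniformly_calibrated_def by (force dest: spec[of _ "1 / 2 :: real"])
    obtain w where w: "w \<in> W"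
      using assms(2) by auto
    from order_tendstoD(2)[OF normal_measure_gap_tendsto_zero[of 1] \<open>0 < \<delta>\<close>]
    obtain k where k: "measure (normal_measure 1 (real (Suc k))) {c. c > 0} -
        measure (normal_measure 1 (real (Suc k))) {c. c < 0} < \<delta>"
      by (auto simp: eventually_sequentially simp del: of_nat_Suc)
    let ?M = "normal_measure 1 (real (Suc k))"
    have sym: "symmetric_distribution ?M" and cont: "continuous_distribution ?M"
      and mean: "mean ?M = 1"
      by (simp_all add: symmetric_distribution_normal_measure
          continuous_distribution_normal_measure mean_normal_measure del: of_nat_Suc)
    have "excess_risk spo_plus ?M 0 < \<delta>"
      using spo_plus_excess_risk_zero_le[OF sym] k by (simp add: mean del: of_nat_Suc)
    then have "excess_risk true_loss ?M 0 < 1 / 2"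
      using \<delta>[OF constant_kernel_in_P_cont_sym[OF w cont sym] w] by blast
    moreover have "excess_risk true_loss ?M 0 \<ge> 1 / 2"
      using true_loss_excess_risk_zero_ge[of ?M] sym
      by (simp add: mean symmetric_distribution_def del: of_nat_Suc)
    ultimately show False
      by simp
  qed
qed

end
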